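(* Let $\mathcal{O}$ be a non-symmetric operad and $\pi\in\mathcal{O}(2)$ a multiplication on $\mathcal{O}$. If $H^3(\mathcal{O},d_\pi)=0$, then every finite order deformation of $\pi$ can be extended to a deformation of the next order; that is, for every deformation $\pi_t=\sum_{i=0}^n\pi_it^i$ of order $n$ there exists $\pi_{n+1}\in\mathcal{O}(2)$ such that $\pi_t+\pi_{n+1}t^{n+1}$ is a deformation of $\pi$ of order $n+1$.
   Context: All vector spaces are over a field $\mathbb{K}$ of characteristic $0$. A non-symmetric operad is a collection $\mathcal{O}=\{\mathcal{O}(n)\}_{n\ge 1}$ of vector spaces with bilinear partial compositions $\circ_i:\mathcal{O}(m)\otimes\mathcal{O}(n)\to\mathcal{O}(m+n-1)$, $1\le i\le m$, such that for $f\in\mathcal{O}(m), g\in\mathcal{O}(n), h\in\mathcal{O}(p)$: $(f\circ_i g)\circ_{i+j-1}h=f\circ_i(g\circ_j h)$ for $1\le i\le m,\ 1\le j\le n$; $(f\circ_i g)\circ_{j+n-1}h=(f\circ_j h)\circ_i g$ for $1\le i<j\le m$; and an element $\mathrm{id}\in\mathcal{O}(1)$ with $f\circ_i\mathrm{id}=f=\mathrm{id}\circ_1 f$. For $f\in\mathcal{O}(n)$ put $|f|=n-1$. The circle product is $f\circ g=\sum_{i=1}^m(-1)^{(i-1)|g|}f\circ_i g$ for $f\in\mathcal{O}(m)$. A multiplication on $\mathcal{O}$ is an element $\pi\in\mathcal{O}(2)$ with $\pi\circ\pi=0$. It defines a differential $d_\pi:\mathcal{O}(n)\to\mathcal{O}(n+1)$,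 $d_\pi f=\pi\circ f-(-1)^{|f|}f\circ\pi$, and $H^n(\mathcal{O},d_\pi)$ denotes the cohomology at $\mathcal{O}(n)$. All operations are extended $\mathbb{K}[[t]]$-linearly to formal power series $\mathcal{O}(n)[[t]]$. A deformation of $\pi$ of order $n$ is a finite sum $\pi_t=\sum_{i=0}^n\pi_it^i$ with $\pi_i\in\mathcal{O}(2)$, $\pi_0=\pi$ and $\pi_t\circ\pi_t\equiv0\pmod{t^{n+1}}$. *)

theory Defs
  imports "HOL-Computational_Algebra.Formal_Power_Series"
begin

text \<open>
  An arity-indexed family of vector spaces \<open>\<O>(n)\<close>, \<open>n \<ge> 1\<close>, is given as a family of subspaces of one
  ambient vector space on the type \<open>'a\<close>. This is no restriction: any family embeds into its direct
  sum, and the subspaces are not required to be independent or even distinct.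
  For this reason the partial compositions carry the arities of their arguments explicitly:
  \<open>pcomp \<O> m n i f g\<close> is \<open>f \<circ>\<^sub>i g\<close> for \<open>f \<in> \<O>(m)\<close> and \<open>g \<in> \<O>(n)\<close>. Nothing is assumed about
  \<open>arity_space \<O> 0\<close>, or about values of \<open>pcomp\<close> outside the ranges stated in the locale.
\<close>

record ('k, 'a) operad_data =
  scalar :: "'k \<Rightarrow> 'a \<Rightarrow> 'a"
  arity_space :: "nat \<Rightarrow> 'a set"
  pcomp :: "nat \<Rightarrow> nat \<Rightarrow> nat \<Rightarrow> 'a \<Rightarrow> 'a \<Rightarrow> 'a"
  operad_id :: 'a

locale ns_operad =
  fixes \<O> :: "('k::field_char_0, 'a::ab_group_add) operad_data"
  assumes vector_space: "vector_space (scalar \<O>)"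
    and subspace: "1 \<le> n \<Longrightarrow> module.subspace (scalar \<O>) (arity_space \<O> n)"
    and pcomp_closed:
      "\<lbrakk>1 \<le> i; i \<le> m; 1 \<le> n; f \<in> arity_space \<O> m; g \<in> arity_space \<O> n\<rbrakk>
        \<Longrightarrow> pcomp \<O> m n i f g \<in> arity_space \<O> (m + n - 1)"
    and pcomp_add_left:
      "\<lbrakk>1 \<le> i; i \<le> m; 1 \<le> n; f \<in> arity_space \<O> m; f' \<in> arity_space \<O> m; g \<in> arity_space \<O> n\<rbrakk>
        \<Longrightarrow> pcomp \<O> m n i (f + f') g = pcomp \<O> m n i f g + pcomp \<O> m n i f' g"
    and pcomp_add_right:
      "\<lbrakk>1 \<le> i; i \<le> m; 1 \<le> n; f \<in> arity_space \<O> m; g \<in> arity_space \<O> n; g' \<in> arity_space \<O> n\<rbrakk>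
        \<Longrightarrow> pcomp \<O> m n i f (g + g') = pcomp \<O> m n i f g + pcomp \<O> m n i f g'"
    and pcomp_scalar_left:
      "\<lbrakk>1 \<le> i; i \<le> m; 1 \<le> n; f \<in> arity_space \<O> m; g \<in> arity_space \<O> n\<rbrakk>
        \<Longrightarrow> pcomp \<O> m n i (scalar \<O> c f) g = scalar \<O> c (pcomp \<O> m n i f g)"
    and pcomp_scalar_right:
      "\<lbrakk>1 \<le> i; i \<le> m; 1 \<le> n; f \<in> arity_space \<O> m; g \<in> arity_space \<O> n\<rbrakk>
        \<Longrightarrow> pcomp \<O> m n i f (scalar \<O> c g) = scalar \<O> c (pcomp \<O> m n i f g)"
    and pcomp_sequential:
      "\<lbrakk>1 \<le> i; i \<le> m; 1 \<le> j; j \<le> n; 1 \<le> p;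
        f \<in> arity_space \<O> m; g \<in> arity_space \<O> n; h \<in> arity_space \<O> p\<rbrakk>
        \<Longrightarrow> pcomp \<O> (m + n - 1) p (i + j - 1) (pcomp \<O> m n i f g) h
          = pcomp \<O> m (n + p - 1) i f (pcomp \<O> n p j g h)"
    and pcomp_parallel:
      "\<lbrakk>1 \<le> i; i < j; j \<le> m; 1 \<le> n; 1 \<le> p;
        f \<in> arity_space \<O> m; g \<in> arity_space \<O> n; h \<in> arity_space \<O> p\<rbrakk>
        \<Longrightarrow> pcomp \<O> (m + n - 1) p (j + n - 1) (pcomp \<O> m n i f g) h
          = pcomp \<O> (m + p - 1) n i (pcomp \<O> m p j f h) g"
    and id_closed: "operad_id \<O> \<in> arity_space \<O> 1"
    and pcomp_id_right:
      "\<lbrakk>1 \<le> i; i \<le> m; f \<in> arity_space \<O> m\<rbrakk> \<Longrightarrow> pcomp \<O> m 1 i f (operad_id \<O>) = f"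
    and pcomp_id_left:
      "\<lbrakk>1 \<le> m; f \<in> arity_space \<O> m\<rbrakk> \<Longrightarrow> pcomp \<O> 1 m 1 (operad_id \<O>) f = f"

text \<open>For \<open>g \<in> \<O>(n)\<close> the degree \<open>|g|\<close> is \<open>n - 1\<close>; arities are always at least 1 here.\<close>

definition circle :: "('k::field_char_0, 'a::ab_group_add) operad_data \<Rightarrow> nat \<Rightarrow> nat \<Rightarrow> 'a \<Rightarrow> 'a \<Rightarrow> 'a"
  where "circle \<O> m n f g = (\<Sum>i=1..m. scalar \<O> ((-1) ^ ((i - 1) * (n - 1))) (pcomp \<O> m n i f g))"

definition multiplication :: "('k::field_char_0, 'a::ab_group_add) operad_data \<Rightarrow> 'a \<Rightarrow> bool"
  where "multiplication \<O> \<pi> \<longleftrightarrow> \<pi> \<in> arity_space \<O> 2 \<and> circle \<O> 2 2 \<pi> \<pi> = 0"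

definition differential :: "('k::field_char_0, 'a::ab_group_add) operad_data \<Rightarrow> 'a \<Rightarrow> nat \<Rightarrow> 'a \<Rightarrow> 'a"
  where "differential \<O> \<pi> n f =
    circle \<O> 2 n \<pi> f - scalar \<O> ((-1) ^ (n - 1)) (circle \<O> n 2 f \<pi>)"

definition cocycles :: "('k::field_char_0, 'a::ab_group_add) operad_data \<Rightarrow> 'a \<Rightarrow> nat \<Rightarrow> 'a set"
  where "cocycles \<O> \<pi> n = {f \<in> arity_space \<O> n. differential \<O> \<pi> n f = 0}"

text \<open>The complex starts in arity 1, so there are no nonzero coboundaries there.\<close>

definition coboundaries :: "('k::field_char_0, 'a::ab_group_add) operad_data \<Rightarrow> 'a \<Rightarrow> nat \<Rightarrow> 'a set"
  where "coboundaries \<O> \<pi> n =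
    (if n \<le> 1 then {0} else differential \<O> \<pi> (n - 1) ` arity_space \<O> (n - 1))"

text \<open>
  The underlying set of the quotient space of cocycles by coboundaries, consisting of cosets.
  Its zero element is the coset \<open>coboundaries \<O> \<pi> n\<close>.
\<close>

definition cohomology :: "('k::field_char_0, 'a::ab_group_add) operad_data \<Rightarrow> 'a \<Rightarrow> nat \<Rightarrow> 'a set set"
  where "cohomology \<O> \<pi> n = (\<lambda>z. (\<lambda>b. z + b) ` coboundaries \<O> \<pi> n) ` cocycles \<O> \<pi> n"

definition cohomology_vanishes ::
    "('k::field_char_0, 'a::ab_group_add) operad_data \<Rightarrow> 'a \<Rightarrow> nat \<Rightarrow> bool"
  where "cohomology_vanishes \<O> \<pi> n \<longleftrightarrow> cohomology \<O> \<pi> n = {coboundaries \<O> \<pi> n}"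

text \<open>The bilinear extension of the circle product to formal power series in \<open>t\<close>.\<close>

definition fps_circle ::
    "('k::field_char_0, 'a::ab_group_add) operad_data \<Rightarrow> nat \<Rightarrow> nat \<Rightarrow> 'a fps \<Rightarrow> 'a fps \<Rightarrow> 'a fps"
  where "fps_circle \<O> m n F G =
    Abs_fps (\<lambda>k. \<Sum>a\<le>k. circle \<O> m n (fps_nth F a) (fps_nth G (k - a)))"

text \<open>The series \<open>a t\<^sup>k\<close>; the coefficients need not form a ring, so there is no \<open>fps_X\<close> here.\<close>

definition fps_monomial :: "'a::zero \<Rightarrow> nat \<Rightarrow> 'a fps"
  where "fps_monomial a k = Abs_fps (\<lambda>i. if i = k then a else 0)"

definition deformation ::
    "('k::field_char_0, 'a::ab_group_add) operad_data \<Rightarrow> 'a \<Rightarrow> nat \<Rightarrow> 'a fps \<Rightarrow> bool"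
  where "deformation \<O> \<pi> n F \<longleftrightarrow>
    (\<exists>p. (\<forall>i\<le>n. p i \<in> arity_space \<O> 2) \<and> p 0 = \<pi> \<and> F = (\<Sum>i\<le>n. fps_monomial (p i) i))
    \<and> (\<forall>k<n + 1. fps_nth (fps_circle \<O> 2 2 F F) k = 0)"

end

theory Submission imports Defs begin

text \<open>
  The associator \<open>(f \<circ> g) \<circ> h - f \<circ> (g \<circ> h)\<close> of the circle product is antisymmetric in
  \<open>g, h \<in> \<O>(2)\<close>, so \<open>(\<pi>\<^sub>t \<circ> \<pi>\<^sub>t) \<circ> \<pi>\<^sub>t = \<pi>\<^sub>t \<circ> (\<pi>\<^sub>t \<circ> \<pi>\<^sub>t)\<close> for every power series \<open>\<pi>\<^sub>t\<close> over \<open>\<O>(2)\<close>.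
  If \<open>\<pi>\<^sub>t\<close> is a deformation of order \<open>n\<close>, the lowest possibly nonzero coefficient of \<open>\<pi>\<^sub>t \<circ> \<pi>\<^sub>t\<close> is
  the obstruction \<open>c\<close> at \<open>t\<^bsup>n+1\<^esup>\<close>, and comparing the coefficients of \<open>t\<^bsup>n+1\<^esup>\<close> above gives
  \<open>c \<circ> \<pi> = \<pi> \<circ> c\<close>, that is, \<open>c\<close> is a cocycle. Writing \<open>c = d\<^sub>\<pi> q\<close>, the extension is by \<open>- q\<close>.
\<close>

section \<open>Deformations in terms of coefficients\<close>

lemma fps_nth_sum_monomial:
  "fps_nth (\<Sum>i\<le>n. fps_monomial (p i) i) k = (if k \<le> n then p k else 0)"
  by (auto simp: fps_sum_nth fps_monomial_def)

text \<open>The witness \<open>p\<close> is determined by \<open>F\<close> for indices up to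
  \<open>n\<close>, so the existential can be eliminated; the finite sum becomes the vanishing of
  all higher coefficients.\<close>

lemma deformation_iff:
  "deformation \<O> \<pi> n F \<longleftrightarrow>
    (\<forall>i. fps_nth F i \<in> (if i \<le> n then arity_space \<O> 2 else {0})) \<and> fps_nth F 0 = \<pi> \<and>
    (\<forall>k\<le>n. fps_nth (fps_circle \<O> 2 2 F F) k = 0)"
  (is "_ \<longleftrightarrow> ?A \<and> ?B \<and> ?C")
proof
  assume "deformation \<O> \<pi> n F"
  then show "?A \<and> ?B \<and> ?C"
    by (auto simp: deformation_def fps_nth_sum_monomial less_Suc_eq_le)
next
  assume R: "?A \<and> ?B \<and> ?C"
  have "F = (\<Sum>i\<le>n. fps_monomial (fps_nth F i) i)"
    using R by (intro fps_ext) (auto simp: fps_nth_sum_monomial dest: spec split: if_splits)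
  moreover have "\<forall>i\<le>n. fps_nth F i \<in> arity_space \<O> 2"
    using R by (metis (full_types))
  ultimately show "deformation \<O> \<pi> n F"
    unfolding deformation_def using R by (auto simp: less_Suc_eq_le)
qed

context ns_operad
begin

interpretation vs: vector_space "scalar \<O>"
  by (rule vector_space)

section \<open>Bilinearity of the circle product\<close>

lemma arity_space_zero: "1 \<le> n \<Longrightarrow> 0 \<in> arity_space \<O> n"
  by (rule vs.subspace_0[OF subspace])

lemma arity_space_uminus: "\<lbrakk>1 \<le> n; f \<in> arity_space \<O> n\<rbrakk> \<Longrightarrow> - f \<in> arity_space \<O> n"
  by (rule vs.subspace_neg[OF subspace])

lemma arity_space_sum:
  "\<lbrakk>1 \<le> n; \<And>x. x \<in> A \<Longrightarrow> f x \<in> arity_space \<O> n\<rbrakk> \<Longrightarrow> sum f A \<in> arity_space \<O> n"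
  by (rule vs.subspace_sum[OF subspace])

lemma circle_closed:
  assumes "1 \<le> m" "1 \<le> n" "f \<in> arity_space \<O> m" "g \<in> arity_space \<O> n"
  shows "circle \<O> m n f g \<in> arity_space \<O> (m + n - 1)"
  unfolding circle_def using assms
  by (intro arity_space_sum vs.subspace_scale[OF subspace] pcomp_closed) auto

lemma circle_add_left:
  assumes "1 \<le> n" "f \<in> arity_space \<O> m" "f' \<in> arity_space \<O> m" "g \<in> arity_space \<O> n"
  shows "circle \<O> m n (f + f') g = circle \<O> m n f g + circle \<O> m n f' g"
  unfolding circle_def sum.distrib[symmetric] using assms
  by (intro sum.cong) (auto simp: pcomp_add_left vs.scale_right_distrib)

lemma circle_add_right:
  assumes "1 \<le> n" "f \<in> arity_space \<O> m" "g \<in> arity_space \<O> n" "g' \<in> arity_space \<O> n"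
  shows "circle \<O> m n f (g + g') = circle \<O> m n f g + circle \<O> m n f g'"
  unfolding circle_def sum.distrib[symmetric] using assms
  by (intro sum.cong) (auto simp: pcomp_add_right vs.scale_right_distrib)

lemma circle_zero_left:
  assumes "1 \<le> m" "1 \<le> n" "g \<in> arity_space \<O> n"
  shows "circle \<O> m n 0 g = 0"
  using circle_add_left[of n 0 m 0 g] assms arity_space_zero by simp

lemma circle_zero_right:
  assumes "1 \<le> n" "f \<in> arity_space \<O> m"
  shows "circle \<O> m n f 0 = 0"
  using circle_add_right[of n f m 0 0] assms arity_space_zero by simp

lemma circle_uminus_left:
  assumes "1 \<le> m" "1 \<le> n" "f \<in> arity_space \<O> m" "g \<in> arity_space \<O> n"
  shows "circle \<O> m n (- f) g = - circle \<O> m n f g"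
  using circle_add_left[of n f m "- f" g] circle_zero_left[of m n g] assms arity_space_uminus
  by (simp add: eq_neg_iff_add_eq_0 add.commute)

lemma circle_uminus_right:
  assumes "1 \<le> n" "f \<in> arity_space \<O> m" "g \<in> arity_space \<O> n"
  shows "circle \<O> m n f (- g) = - circle \<O> m n f g"
  using circle_add_right[of n f m g "- g"] circle_zero_right[of n f m] assms arity_space_uminus
  by (simp add: eq_neg_iff_add_eq_0 add.commute)

lemma circle_sum_left:
  assumes "1 \<le> m" "1 \<le> n" "g \<in> arity_space \<O> n" "\<And>x. x \<in> A \<Longrightarrow> f x \<in> arity_space \<O> m"
  shows "circle \<O> m n (sum f A) g = (\<Sum>x\<in>A. circle \<O> m n (f x) g)"
  using assms
  by (induction A rule: infinite_finite_induct)
    (auto simp: circle_zero_left circle_add_left arity_space_sum)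

lemma circle_sum_right:
  assumes "1 \<le> n" "f \<in> arity_space \<O> m" "\<And>x. x \<in> A \<Longrightarrow> g x \<in> arity_space \<O> n"
  shows "circle \<O> m n f (sum g A) = (\<Sum>x\<in>A. circle \<O> m n f (g x))"
  using assms
  by (induction A rule: infinite_finite_induct)
    (auto simp: circle_zero_right circle_add_right arity_space_sum)

lemma pcomp_diff_left:
  assumes "1 \<le> i" "i \<le> m" "1 \<le> n" "f \<in> arity_space \<O> m" "f' \<in> arity_space \<O> m" "g \<in> arity_space \<O> n"
  shows "pcomp \<O> m n i (f - f') g = pcomp \<O> m n i f g - pcomp \<O> m n i f' g"
  using pcomp_add_left[of i m n "f - f'" f' g] vs.subspace_diff[OF subspace] assms
  by (simp add: eq_diff_eq)

lemma pcomp_diff_right: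
  assumes "1 \<le> i" "i \<le> m" "1 \<le> n" "f \<in> arity_space \<O> m" "g \<in> arity_space \<O> n" "g' \<in> arity_space \<O> n"
  shows "pcomp \<O> m n i f (g - g') = pcomp \<O> m n i f g - pcomp \<O> m n i f g'"
  using pcomp_add_right[of i m n f "g - g'" g'] vs.subspace_diff[OF subspace] assms
  by (simp add: eq_diff_eq)

section \<open>The associator in arity two\<close>

lemma circle_2_2: "circle \<O> 2 2 f g = pcomp \<O> 2 2 1 f g - pcomp \<O> 2 2 2 f g"
  by (simp add: circle_def numeral_2_eq_2)

text \<open>No signs alternate here: \<open>g\<close> has even degree 2.\<close>

lemma circle_2_3: "circle \<O> 2 3 f g = pcomp \<O> 2 3 1 f g + pcomp \<O> 2 3 2 f g"
  by (simp add: circle_def numeral_2_eq_2)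

lemma circle_3_2: "circle \<O> 3 2 f g = pcomp \<O> 3 2 1 f g - pcomp \<O> 3 2 2 f g + pcomp \<O> 3 2 3 f g"
  by (simp add: circle_def numeral_3_eq_3 numeral_2_eq_2)

text \<open>Of the six terms of the iterated product on the left, the sequential axiom cancels four.
  The other two insert \<open>g\<close> and \<open>h\<close> into different inputs of
  \<open>f\<close>, and the parallel axiom makes their antisymmetry in \<open>g\<close>,
  \<open>h\<close> visible.\<close>

lemma circle_associator_2_2_2:
  assumes f: "f \<in> arity_space \<O> 2" and g: "g \<in> arity_space \<O> 2" and h: "h \<in> arity_space \<O> 2"
  shows "circle \<O> 3 2 (circle \<O> 2 2 f g) h - circle \<O> 2 3 f (circle \<O> 2 2 g h)
    = pcomp \<O> 3 2 3 (pcomp \<O> 2 2 1 f g) h - pcomp \<O> 3 2 3 (pcomp \<O> 2 2 1 f h) g"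
proof -
  have closed: "pcomp \<O> 2 2 i x y \<in> arity_space \<O> 3"
    if "i = 1 \<or> i = 2" "x \<in> arity_space \<O> 2" "y \<in> arity_space \<O> 2" for i x y
    using that pcomp_closed[of i 2 2 x y] by auto
  have seq: "pcomp \<O> 3 2 k (pcomp \<O> 2 2 i f g) h = pcomp \<O> 2 3 i f (pcomp \<O> 2 2 j g h)"
    if "i \<in> {1, 2}" "j \<in> {1, 2}" "k = i + j - 1" for i j k
    using that pcomp_sequential[of i 2 j 2 2 f g h] f g h by auto
  \<comment> \<open>The parallel axiom with \<open>g\<close> and \<open>h\<close> exchanged, read
    from right to left.\<close>
  have par: "pcomp \<O> 3 2 1 (pcomp \<O> 2 2 2 f g) h = pcomp \<O> 3 2 3 (pcomp \<O> 2 2 1 f h) g"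
    using pcomp_parallel[of 1 2 2 2 2 f h g] f g h by simp
  have left: "pcomp \<O> 3 2 k (circle \<O> 2 2 f g) h =
      pcomp \<O> 3 2 k (pcomp \<O> 2 2 1 f g) h - pcomp \<O> 3 2 k (pcomp \<O> 2 2 2 f g) h"
    if "k \<in> {1, 2, 3}" for k
    unfolding circle_2_2 using that f g h by (intro pcomp_diff_left closed) auto
  have right: "pcomp \<O> 2 3 k f (circle \<O> 2 2 g h) =
      pcomp \<O> 2 3 k f (pcomp \<O> 2 2 1 g h) - pcomp \<O> 2 3 k f (pcomp \<O> 2 2 2 g h)"
    if "k \<in> {1, 2}" for k
    unfolding circle_2_2 using that f g h by (intro pcomp_diff_right closed) auto
  show ?thesis
    unfolding circle_3_2 circle_2_3
    using seq[of 1 1 1] seq[of 1 2 2] seq[of 2 1 2] seq[of 2 2 3]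
    by (simp add: left right par del: One_nat_def)
qed

lemma fps_circle_self_assoc:
  assumes F: "\<And>i. fps_nth F i \<in> arity_space \<O> 2"
  shows "fps_circle \<O> 3 2 (fps_circle \<O> 2 2 F F) F = fps_circle \<O> 2 3 F (fps_circle \<O> 2 2 F F)"
proof (rule fps_ext)
  fix n
  let ?f = "fps_nth F"
  let ?L = "\<lambda>a b c. circle \<O> 3 2 (circle \<O> 2 2 (?f a) (?f b)) (?f c)"
  let ?R = "\<lambda>a b c. circle \<O> 2 3 (?f a) (circle \<O> 2 2 (?f b) (?f c))"
  let ?T = "\<lambda>a b c. pcomp \<O> 3 2 3 (pcomp \<O> 2 2 1 (?f a) (?f b)) (?f c)"
  have closed: "circle \<O> 2 2 (?f a) (?f b) \<in> arity_space \<O> 3" for a b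
    using circle_closed[of 2 2 "?f a" "?f b"] F by simp
  \<comment> \<open>With the first index fixed, the associators are summed over all pairs of the
    other two indices with sum \<open>m\<close>. Swapping these indices turns one \<open>?T\<close>
    sum into the other, so the total is 0.\<close>
  have inner: "(\<Sum>b\<le>m. ?L a b (m - b)) = (\<Sum>b\<le>m. ?R a b (m - b))" for a m
  proof -
    have "(\<Sum>b\<le>m. ?L a b (m - b)) - (\<Sum>b\<le>m. ?R a b (m - b))
        = (\<Sum>b\<le>m. ?T a b (m - b)) - (\<Sum>b\<le>m. ?T a (m - b) b)"
      by (simp only: sum_subtractf[symmetric] circle_associator_2_2_2[OF F F F])
    also have "(\<Sum>b\<le>m. ?T a (m - b) b) = (\<Sum>b\<le>m. ?T a b (m - b))"
      by (rule sum.reindex_bij_witness[of _ "\<lambda>b. m - b" "\<lambda>b. m - b"]) auto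
    finally show ?thesis by simp
  qed
  have "fps_nth (fps_circle \<O> 3 2 (fps_circle \<O> 2 2 F F) F) n
      = (\<Sum>j\<le>n. \<Sum>i\<le>j. ?L i (j - i) (n - j))"
    by (simp add: fps_circle_def circle_sum_left F closed)
  also have "\<dots> = (\<Sum>j\<le>n. \<Sum>i\<le>n - j. ?L j i (n - j - i))"
    \<comment> \<open>Regroups the sum over all triples of indices with sum \<open>n\<close> so that
      the first index is outermost, as \<open>inner\<close> requires.\<close>
    using fps_mult_assoc_lemma[of ?L n n] by (simp add: atLeast0AtMost)
  also have "\<dots> = (\<Sum>j\<le>n. \<Sum>i\<le>n - j. ?R j i (n - j - i))"
    by (simp only: inner)
  also have "\<dots> = fps_nth (fps_circle \<O> 2 3 F (fps_circle \<O> 2 2 F F)) n"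
    by (simp add: fps_circle_def circle_sum_right F closed)
  finally show "fps_nth (fps_circle \<O> 3 2 (fps_circle \<O> 2 2 F F) F) n
      = fps_nth (fps_circle \<O> 2 3 F (fps_circle \<O> 2 2 F F)) n" .
qed

section \<open>The obstruction class and its removal\<close>

lemma obstruction_cocycle:
  assumes F: "\<And>i. fps_nth F i \<in> arity_space \<O> 2"
    and low: "\<And>k. k < m \<Longrightarrow> fps_nth (fps_circle \<O> 2 2 F F) k = 0"
  shows "fps_nth (fps_circle \<O> 2 2 F F) m \<in> cocycles \<O> (fps_nth F 0) 3"
proof -
  let ?S = "fps_nth (fps_circle \<O> 2 2 F F)"
  have closed: "?S k \<in> arity_space \<O> 3" for k
    using circle_closed[of 2 2] F by (auto simp: fps_circle_def intro!: arity_space_sum)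
  \<comment> \<open>Since \<open>?S k\<close> vanishes below \<open>m\<close>, one summand survives
    on each side: the index belongs to \<open>?S\<close> here, but to \<open>F\<close> in the next
    sum, hence \<open>k = m\<close> and then \<open>k = 0\<close>.\<close>
  have "fps_nth (fps_circle \<O> 3 2 (fps_circle \<O> 2 2 F F) F) m
      = (\<Sum>k\<le>m. if k = m then circle \<O> 3 2 (?S m) (fps_nth F 0) else 0)"
    unfolding fps_circle_def[of \<O> 3 2] fps_nth_Abs_fps
    by (intro sum.cong) (auto simp: low circle_zero_left F)
  moreover have "fps_nth (fps_circle \<O> 2 3 F (fps_circle \<O> 2 2 F F)) m
      = (\<Sum>k\<le>m. if k = 0 then circle \<O> 2 3 (fps_nth F 0) (?S m) else 0)"
    unfolding fps_circle_def[of \<O> 2 3] fps_nth_Abs_fps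
    by (intro sum.cong) (auto simp: low circle_zero_right F)
  ultimately have "circle \<O> 3 2 (?S m) (fps_nth F 0) = circle \<O> 2 3 (fps_nth F 0) (?S m)"
    using fps_circle_self_assoc[OF F] by simp
  then show ?thesis
    \<comment> \<open>In arity 3 the sign in the differential is +1, so equality of the two products
      is the cocycle condition.\<close>
    by (simp add: cocycles_def differential_def closed)
qed

text \<open>Cohomology consists of cosets, so its vanishing says that the coset of \<open>z\<close>
  equals the set of coboundaries; as 0 is a coboundary, \<open>z\<close> lies in it.\<close>

lemma cocycle_is_coboundary:
  assumes \<pi>: "\<pi> \<in> arity_space \<O> 2" and vanish: "cohomology_vanishes \<O> \<pi> (Suc n)" and "1 \<le> n"
    and z: "z \<in> cocycles \<O> \<pi> (Suc n)"
  shows "\<exists>q \<in> arity_space \<O> n. z = differential \<O> \<pi> n q"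
proof -
  have "differential \<O> \<pi> n 0 = 0"
    using \<pi> \<open>1 \<le> n\<close> by (simp add: differential_def circle_zero_left circle_zero_right)
  then have "0 \<in> coboundaries \<O> \<pi> (Suc n)"
    using \<open>1 \<le> n\<close> arity_space_zero[of n] by (force simp: coboundaries_def)
  moreover have "(\<lambda>b. z + b) ` coboundaries \<O> \<pi> (Suc n) = coboundaries \<O> \<pi> (Suc n)"
    using vanish z unfolding cohomology_vanishes_def cohomology_def by blast
  ultimately have "z \<in> coboundaries \<O> \<pi> (Suc n)"
    by (metis add.right_neutral imageI)
  then show ?thesis
    using \<open>1 \<le> n\<close> by (auto simp: coboundaries_def)
qed

text \<open>The term quadratic in \<open>q\<close> has order \<open>2 * m\<close>, beyond
  \<open>m\<close> because \<open>m\<close> is positive. Up to order \<open>m\<close> only the two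
  cross terms with the constant coefficient are new.\<close>

lemma fps_circle_add_monomial:
  assumes F: "\<And>i. fps_nth F i \<in> arity_space \<O> 2" and q: "q \<in> arity_space \<O> 2"
    and "0 < m" "fps_nth F m = 0" "k \<le> m"
  shows "fps_nth (fps_circle \<O> 2 2 (F + fps_monomial q m) (F + fps_monomial q m)) k
    = fps_nth (fps_circle \<O> 2 2 F F) k
      + (if k = m then circle \<O> 2 2 (fps_nth F 0) q + circle \<O> 2 2 q (fps_nth F 0) else 0)"
proof -
  let ?f = "fps_nth F"
  \<comment> \<open>The cross terms sit at the ends \<open>a = 0\<close> and \<open>a = k\<close> of
    the convolution, and only if \<open>k = m\<close>.\<close>
  have "circle \<O> 2 2 (fps_nth (F + fps_monomial q m) a) (fps_nth (F + fps_monomial q m) (k - a))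
      = circle \<O> 2 2 (?f a) (?f (k - a))
        + ((if a = 0 then if k = m then circle \<O> 2 2 (?f 0) q else 0 else 0)
          + (if a = k then if k = m then circle \<O> 2 2 q (?f 0) else 0 else 0))"
    if "a \<le> k" for a
    using that assms by (auto simp: fps_monomial_def circle_zero_left circle_zero_right)
  then show ?thesis
    by (simp add: fps_circle_def sum.distrib)
qed

lemma deformation_extends:
  assumes vanish: "cohomology_vanishes \<O> \<pi> 3" and def: "deformation \<O> \<pi> n F"
  shows "\<exists>\<pi>' \<in> arity_space \<O> 2. deformation \<O> \<pi> (n + 1) (F + fps_monomial \<pi>' (n + 1))"
proof -
  have F: "fps_nth F i \<in> arity_space \<O> 2" and high: "i > n \<Longrightarrow> fps_nth F i = 0"
    and F0: "fps_nth F 0 = \<pi>"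
    and low: "k \<le> n \<Longrightarrow> fps_nth (fps_circle \<O> 2 2 F F) k = 0" for i k
    using def arity_space_zero[of 2] unfolding deformation_iff
    by (auto split: if_splits dest: spec[of _ i])
  let ?c = "fps_nth (fps_circle \<O> 2 2 F F) (n + 1)"
  have \<pi>: "\<pi> \<in> arity_space \<O> 2"
    using F[of 0] F0 by simp
  have "?c \<in> cocycles \<O> \<pi> 3"
    using obstruction_cocycle[of F "n + 1"] F low F0 by simp
  then obtain q where q: "q \<in> arity_space \<O> 2" and c: "?c = differential \<O> \<pi> 2 q"
    using cocycle_is_coboundary[of \<pi> 2 ?c] \<pi> vanish by auto
  \<comment> \<open>In arity 2 the sign is -1, so the differential is the symmetric sum that appears
    as the cross terms.\<close>
  have c_eq: "?c = circle \<O> 2 2 \<pi> q + circle \<O> 2 2 q \<pi>"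
    using c by (simp add: differential_def)
  have q': "- q \<in> arity_space \<O> 2"
    using arity_space_uminus q by simp
  \<comment> \<open>With \<open>- q\<close> the cross terms contribute \<open>- ?c\<close> at order
    \<open>n + 1\<close>, cancelling the obstruction.\<close>
  let ?G = "F + fps_monomial (- q) (n + 1)"
  have "fps_nth (fps_circle \<O> 2 2 ?G ?G) k = 0" if "k \<le> n + 1" for k
  proof (cases "k = n + 1")
    case True
    then show ?thesis
      using fps_circle_add_monomial[of F "- q" "n + 1" k] F q q' high F0 \<pi> c_eq
      by (simp add: circle_uminus_left circle_uminus_right)
  next
    case False
    then show ?thesis
      using fps_circle_add_monomial[of F "- q" "n + 1" k] F q' high that low by simp
  qed
  then have "deformation \<O> \<pi> (n + 1) ?G"
    unfolding deformation_iff using F high F0 q' by (auto simp: fps_monomial_def le_Suc_eq)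
  then show ?thesis
    using q' by blast
qed

end

theorem theorem3p7:
  fixes \<O> :: "('k::field_char_0, 'a::ab_group_add) operad_data"
    and \<pi> :: 'a
  assumes "ns_operad \<O>"
    and "multiplication \<O> \<pi>"
    and "cohomology_vanishes \<O> \<pi> 3"
  shows "\<forall>n \<pi>\<^sub>t. deformation \<O> \<pi> n \<pi>\<^sub>t \<longrightarrow>
    (\<exists>\<pi>' \<in> arity_space \<O> 2. deformation \<O> \<pi> (n + 1) (\<pi>\<^sub>t + fps_monomial \<pi>' (n + 1)))"
  using ns_operad.deformation_extends[OF assms(1,3)] by blast

end
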